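(* Let $\mathcal{P}=\{X_i\mid i\in I\}$ be a partition of a nonempty set $X$ and let $f\in\Sigma(X,\mathcal{P})$. Then $f$ is regular in $\Sigma(X,\mathcal{P})$ if and only if $\chi^{(f)}$ is regular in $\Gamma(I)$ (i.e. $\chi^{(f)}\in\mathrm{reg}(\Gamma(I))$).
   Context: Maps are written to the right of their arguments and composed from left to right; $Af$ denotes the image of $A$ under $f$. A partition $\mathcal{P}=\{X_i\mid i\in I\}$ of $X$ is a collection of nonempty pairwise disjoint subsets (blocks) with union $X$, with distinct indices giving distinct blocks. $T(X)$ is the monoid of all selfmaps of $X$ under composition. $T(X,\mathcal{P})=\{f\in T(X)\mid (\forall X_i\in\mathcal{P})(\exists X_j\in\mathcal{P})\ X_if\subseteq X_j\}$, and $\Sigma(X,\mathcal{P})=\{f\in T(X,\mathcal{P})\mid (\forall X_i\in\mathcal{P})\ Xf\cap X_i\neq\emptyset\}$, a submonoid of $T(X,\mathcal{P})$. For $f\in T(X,\mathcal{P})$, the character $\chi^{(f)}\colon I\to I$ is defined by $i\chi^{(f)}=j$ whenever $X_if\subseteq X_j$. $\Gamma(I)$ is the monoid of all surjective maps $I\to I$. An element $x$ of a monoid $M$ is regular in $M$ if there is $y\in M$ with $xyx=x$; $\mathrm{reg}(M)$ is the set of regular elements of $M$. *)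

theory Defs
  imports "HOL-Algebra.Group" "HOL-Library.Disjoint_Sets" "HOL-Library.FuncSet"
begin

definition indexed_partition :: "'a set \<Rightarrow> 'i set \<Rightarrow> ('i \<Rightarrow> 'a set) \<Rightarrow> bool" where
  "indexed_partition X I P \<longleftrightarrow> partition_on X (P ` I) \<and> inj_on P I"

(* Selfmaps of a set A are represented by the extensional functions in A \<rightarrow>\<^sub>E A, so that
   equality of functions is equality of maps on A. *)

definition T_part :: "'a set \<Rightarrow> 'i set \<Rightarrow> ('i \<Rightarrow> 'a set) \<Rightarrow> ('a \<Rightarrow> 'a) set" where
  "T_part X I P = {f \<in> X \<rightarrow>\<^sub>E X. \<forall>i\<in>I. \<exists>j\<in>I. f ` P i \<subseteq> P j}"

definition Sigma_part :: "'a set \<Rightarrow> 'i set \<Rightarrow> ('i \<Rightarrow> 'a set) \<Rightarrow> ('a \<Rightarrow> 'a) set" where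
  "Sigma_part X I P = {f \<in> T_part X I P. \<forall>i\<in>I. f ` X \<inter> P i \<noteq> {}}"

definition Gamma_maps :: "'i set \<Rightarrow> ('i \<Rightarrow> 'i) set" where
  "Gamma_maps I = {f \<in> I \<rightarrow>\<^sub>E I. f ` I = I}"

(* The index j is unique for f in T_part X I P when P is an indexed partition
   (see character_eqI). *)
definition character :: "'i set \<Rightarrow> ('i \<Rightarrow> 'a set) \<Rightarrow> ('a \<Rightarrow> 'a) \<Rightarrow> 'i \<Rightarrow> 'i" where
  "character I P f = (\<lambda>i\<in>I. THE j. j \<in> I \<and> f ` P i \<subseteq> P j)"

(* Maps act on the right: the product of f and g is "first f, then g". *)
definition transf_monoid :: "'a set \<Rightarrow> ('a \<Rightarrow> 'a) set \<Rightarrow> ('a \<Rightarrow> 'a) monoid" where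
  "transf_monoid A S = \<lparr>carrier = S, monoid.mult = (\<lambda>f g. compose A g f), one = (\<lambda>x\<in>A. x)\<rparr>"

definition Sigma_monoid :: "'a set \<Rightarrow> 'i set \<Rightarrow> ('i \<Rightarrow> 'a set) \<Rightarrow> ('a \<Rightarrow> 'a) monoid" where
  "Sigma_monoid X I P = transf_monoid X (Sigma_part X I P)"

definition Gamma_monoid :: "'i set \<Rightarrow> ('i \<Rightarrow> 'i) monoid" where
  "Gamma_monoid I = transf_monoid I (Gamma_maps I)"

definition reg :: "('a, 'b) monoid_scheme \<Rightarrow> 'a set" where
  "reg M = {x \<in> carrier M. \<exists>y\<in>carrier M. x \<otimes>\<^bsub>M\<^esub> y \<otimes>\<^bsub>M\<^esub> x = x}"

lemma indexed_partitionD: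
  assumes "indexed_partition X I P"
  shows "\<And>i. i \<in> I \<Longrightarrow> P i \<noteq> {}" "(\<Union>i\<in>I. P i) = X"
    "\<And>i j x. i \<in> I \<Longrightarrow> j \<in> I \<Longrightarrow> x \<in> P i \<Longrightarrow> x \<in> P j \<Longrightarrow> i = j"
proof -
  have pt: "partition_on X (P ` I)" and inj: "inj_on P I"
    using assms by (auto simp: indexed_partition_def)
  show "\<And>i. i \<in> I \<Longrightarrow> P i \<noteq> {}" using pt by (auto simp: partition_on_def)
  show "(\<Union>i\<in>I. P i) = X" using pt by (auto simp: partition_on_def)
  fix i j x assume *: "i \<in> I" "j \<in> I" "x \<in> P i" "x \<in> P j"
  have "P i = P j"
    using pt * unfolding partition_on_def disjoint_def by blast
  with inj * show "i = j" by (auto dest: inj_onD)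
qed

lemma character_eqI:
  assumes "indexed_partition X I P" "i \<in> I" "j \<in> I" "f ` P i \<subseteq> P j"
  shows "character I P f i = j"
proof -
  obtain x where x: "x \<in> P i" using indexed_partitionD(1)[OF assms(1,2)] by blast
  have "(THE j. j \<in> I \<and> f ` P i \<subseteq> P j) = j"
  proof (rule the_equality)
    fix k assume "k \<in> I \<and> f ` P i \<subseteq> P k"
    then show "k = j"
      using x assms(3,4) by (intro indexed_partitionD(3)[OF assms(1), of _ _ "f x"]) auto
  qed (use assms in auto)
  then show ?thesis using assms(2) by (simp add: character_def)
qed

lemma character_in_Gamma_maps:
  assumes P: "indexed_partition X I P" and f: "f \<in> Sigma_part X I P"
  shows "character I P f \<in> Gamma_maps I"
proof -
  have ch: "character I P f i \<in> I \<and> f ` P i \<subseteq> P (character I P f i)" if i: "i \<in> I" for i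
  proof -
    obtain j where "j \<in> I" "f ` P i \<subseteq> P j"
      using f i by (auto simp: Sigma_part_def T_part_def)
    then show ?thesis using character_eqI[OF P i] by simp
  qed
  have "j \<in> character I P f ` I" if j: "j \<in> I" for j
  proof -
    obtain x where x: "x \<in> X" "f x \<in> P j" using f j by (auto simp: Sigma_part_def)
    then obtain i where i: "i \<in> I" "x \<in> P i" using indexed_partitionD(2)[OF P] by auto
    then have "f x \<in> P (character I P f i)" using ch by blast
    then have "character I P f i = j" using indexed_partitionD(3)[OF P] ch i(1) j x(2) by blast
    with i(1) show ?thesis by blast
  qed
  moreover have "character I P f \<in> I \<rightarrow>\<^sub>E I"
    using ch by (simp add: PiE_iff) (simp add: character_def)
  ultimately show ?thesis using ch by (auto simp: Gamma_maps_def)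
qed

lemma transf_monoid_is_monoid:
  assumes "S \<subseteq> A \<rightarrow>\<^sub>E A" "(\<lambda>x\<in>A. x) \<in> S" "\<And>f g. f \<in> S \<Longrightarrow> g \<in> S \<Longrightarrow> compose A g f \<in> S"
  shows "Group.monoid (transf_monoid A S)"
proof (rule monoidI)
  fix f assume "f \<in> carrier (transf_monoid A S)"
  then have f: "f \<in> A \<rightarrow> A" "f \<in> extensional A"
    using assms(1) by (auto simp: transf_monoid_def PiE_def)
  show "\<one>\<^bsub>transf_monoid A S\<^esub> \<otimes>\<^bsub>transf_monoid A S\<^esub> f = f"
    by (simp add: transf_monoid_def compose_Id[OF f])
  show "f \<otimes>\<^bsub>transf_monoid A S\<^esub> \<one>\<^bsub>transf_monoid A S\<^esub> = f"
    by (simp add: transf_monoid_def Id_compose[OF f])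
  fix g h
  show "f \<otimes>\<^bsub>transf_monoid A S\<^esub> g \<otimes>\<^bsub>transf_monoid A S\<^esub> h =
      f \<otimes>\<^bsub>transf_monoid A S\<^esub> (g \<otimes>\<^bsub>transf_monoid A S\<^esub> h)"
    by (simp add: transf_monoid_def compose_assoc[OF f(1)])
qed (simp_all add: transf_monoid_def assms(2,3))

lemma monoid_Gamma: "Group.monoid (Gamma_monoid I)"
  unfolding Gamma_monoid_def
proof (rule transf_monoid_is_monoid)
  show "Gamma_maps I \<subseteq> I \<rightarrow>\<^sub>E I" by (auto simp: Gamma_maps_def)
  show "(\<lambda>x\<in>I. x) \<in> Gamma_maps I" by (simp add: Gamma_maps_def)
  fix f g assume "f \<in> Gamma_maps I" "g \<in> Gamma_maps I"
  then show "compose I g f \<in> Gamma_maps I"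
    using funcset_compose[of f I I g I] surj_compose[of f I I g I]
    by (simp add: Gamma_maps_def PiE_def)
qed

lemma monoid_Sigma:
  assumes P: "indexed_partition X I P"
  shows "Group.monoid (Sigma_monoid X I P)"
  unfolding Sigma_monoid_def
proof (rule transf_monoid_is_monoid)
  note PD = indexed_partitionD[OF P]
  have sub: "P i \<subseteq> X" if "i \<in> I" for i using PD(2) that by blast
  show "Sigma_part X I P \<subseteq> X \<rightarrow>\<^sub>E X" by (auto simp: Sigma_part_def T_part_def)
  have "(\<lambda>x\<in>X. x) ` P i = P i" if "i \<in> I" for i
    using sub[OF that] by force
  moreover have "X \<inter> P i \<noteq> {}" if "i \<in> I" for i
    using PD(1) sub that by blast
  ultimately show "(\<lambda>x\<in>X. x) \<in> Sigma_part X I P"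
    by (auto simp: Sigma_part_def T_part_def)
  fix f g assume f: "f \<in> Sigma_part X I P" and g: "g \<in> Sigma_part X I P"
  have fX: "f \<in> X \<rightarrow> X" and gX: "g \<in> X \<rightarrow> X"
    using f g by (auto simp: Sigma_part_def T_part_def)
  have 1: "\<exists>j\<in>I. compose X g f ` P i \<subseteq> P j" if i: "i \<in> I" for i
  proof -
    obtain j where j: "j \<in> I" "f ` P i \<subseteq> P j" using f i by (auto simp: Sigma_part_def T_part_def)
    obtain k where k: "k \<in> I" "g ` P j \<subseteq> P k" using g j by (auto simp: Sigma_part_def T_part_def)
    have "compose X g f ` P i \<subseteq> P k" using j(2) k(2) sub[OF i] by (auto simp: compose_def)
    with k(1) show ?thesis by blast
  qed
  have 2: "compose X g f ` X \<inter> P k \<noteq> {}" if k: "k \<in> I" for k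
  proof -
    obtain y where y: "y \<in> X" "g y \<in> P k" using g k by (auto simp: Sigma_part_def)
    obtain j where j: "j \<in> I" "y \<in> P j" using y PD(2) by auto
    obtain l where l: "l \<in> I" "g ` P j \<subseteq> P l" using g j by (auto simp: Sigma_part_def T_part_def)
    have "l = k" using PD(3)[of l k "g y"] l j y k by blast
    moreover obtain x where "x \<in> X" "f x \<in> P j" using f j by (auto simp: Sigma_part_def)
    ultimately have "compose X g f x \<in> P k" using l by (auto simp: compose_def)
    with \<open>x \<in> X\<close> show ?thesis by blast
  qed
  show "compose X g f \<in> Sigma_part X I P"
    using 1 2 funcset_compose[OF fX gX] by (simp add: Sigma_part_def T_part_def PiE_def)
qed

end

(* In Gamma(I) the regular elements are exactly the bijections: if c is surjective and g is a
   surjective pseudo-inverse of c, then "g, then c" is the identity, so g is injective, hence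
   bijective, and c is its inverse.  When the character c of f is a bijection with inverse g, a
   point of the block X_j has all of its f-preimages in the single block X_(jg); a choice of
   such preimages, completed by arbitrary elements of X_(jg) at points outside the range of f,
   is a pseudo-inverse of f with character g.  The converse holds because the character map
   is a homomorphism. *)
theory Submission
  imports Defs
begin

lemma reg_transf_monoid_iff:
  "f \<in> reg (transf_monoid A S) \<longleftrightarrow>
    f \<in> S \<and> (\<exists>g\<in>S. compose A f (compose A g f) = f)"
  by (auto simp: reg_def transf_monoid_def)

lemma compose_pseudo_inverseD:
  assumes "compose A f (compose A g f) = f" "x \<in> A"
  shows "f (g (f x)) = f x"
  using fun_cong[OF assms(1), of x] assms(2) by (simp add: compose_eq)

lemma character_mem_image:
  assumes "indexed_partition X I P" "f \<in> T_part X I P" "i \<in> I"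
  shows "character I P f i \<in> I" "f ` P i \<subseteq> P (character I P f i)"
proof -
  obtain j where "j \<in> I" "f ` P i \<subseteq> P j"
    using assms by (auto simp: T_part_def)
  then show "character I P f i \<in> I" "f ` P i \<subseteq> P (character I P f i)"
    using character_eqI[OF assms(1,3)] by auto
qed

text \<open>Following a block through \<open>f\<close> and then through \<open>g\<close> ends inside
  a single block, whose index \<open>character_eqI\<close> pins down. Off \<open>I\<close> both
  sides are \<open>undefined\<close>. This carries pseudo-inverses of \<open>f\<close> over to its
  character.\<close>

lemma character_compose:
  assumes P: "indexed_partition X I P" and f: "f \<in> T_part X I P" and g: "g \<in> T_part X I P"
  shows "character I P (compose X g f) = compose I (character I P g) (character I P f)"
proof
  fix i
  show "character I P (compose X g f) i = compose I (character I P g) (character I P f) i"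
  proof (cases "i \<in> I")
    case True
    note fi = character_mem_image[OF P f True]
    note gi = character_mem_image[OF P g fi(1)]
    have "P i \<subseteq> X" using indexed_partitionD(2)[OF P] True by blast
    then have "compose X g f ` P i \<subseteq> P (character I P g (character I P f i))"
      using fi(2) gi(2) by (auto simp: compose_def)
    then show ?thesis
      using character_eqI[OF P True gi(1)] True by (simp add: compose_eq)
  qed (simp add: character_def compose_def)
qed

lemma Gamma_maps_preimage:
  assumes "f \<in> Gamma_maps I" "i \<in> I"
  shows "\<exists>j\<in>I. i = f j"
proof -
  have "i \<in> f ` I" using assms by (simp add: Gamma_maps_def)
  then show ?thesis by (simp add: image_iff)
qed

text \<open>Surjectivity enters twice: writing \<open>j\<close> as \<open>c k\<close> turns the
  pseudo-inverse equation into \<open>c (g j) = j\<close>; writing \<open>i\<close> as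
  \<open>g k\<close> then gives \<open>g (c i) = g k = i\<close>.\<close>

lemma Gamma_pseudo_inverse_is_left_inverse:
  assumes c: "c \<in> Gamma_maps I" and g: "g \<in> Gamma_maps I"
    and eq: "compose I c (compose I g c) = c" and i: "i \<in> I"
  shows "g (c i) = i"
proof -
  have cg: "c (g j) = j" if j: "j \<in> I" for j
  proof -
    obtain k where "k \<in> I" "j = c k" using Gamma_maps_preimage[OF c j] by blast
    then show ?thesis using compose_pseudo_inverseD[OF eq] by simp
  qed
  obtain k where "k \<in> I" "i = g k" using Gamma_maps_preimage[OF g i] by blast
  then show ?thesis using cg by simp
qed

lemma Sigma_pseudo_inverse_exists:
  assumes P: "indexed_partition X I P" and f: "f \<in> Sigma_part X I P"
    and g: "g \<in> Gamma_maps I"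
    and gc: "\<And>i. i \<in> I \<Longrightarrow> g (character I P f i) = i"
  shows "\<exists>h\<in>Sigma_part X I P. compose X f (compose X h f) = f"
proof -
  note PD = indexed_partitionD[OF P]
  have fT: "f \<in> T_part X I P" using f by (simp add: Sigma_part_def)
  have fE: "f \<in> X \<rightarrow>\<^sub>E X" using fT by (simp add: T_part_def)
  have gI: "g i \<in> I" if "i \<in> I" for i using g that by (auto simp: Gamma_maps_def)
  have sub: "P i \<subseteq> X" if "i \<in> I" for i using PD(2) that by blast
  \<comment> \<open>Both demands on the future value at \<open>x\<close> are stated pointwise, so
    that choice yields \<open>h\<close>. Quantifying over all \<open>j\<close> avoids naming the
    block of \<open>x\<close>, which is unique anyway.\<close>
  have "\<exists>z. (\<forall>j\<in>I. x \<in> P j \<longrightarrow> z \<in> P (g j)) \<and> (x \<in> f ` X \<longrightarrow> f z = x)" if x: "x \<in> X" for x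
  proof -
    obtain j where j: "j \<in> I" "x \<in> P j" using x PD(2) by blast
    have uniq: "k = j" if "k \<in> I" "x \<in> P k" for k using PD(3) that j by blast
    show ?thesis
    proof (cases "x \<in> f ` X")
      case True
      then obtain z where z: "z \<in> X" "x = f z" by blast
      obtain i where i: "i \<in> I" "z \<in> P i" using z(1) PD(2) by blast
      \<comment> \<open>The point \<open>x = f z\<close> lies in the block that receives
        \<open>P i\<close>, so that block is \<open>P j\<close>; hence \<open>g\<close> sends
        \<open>j\<close> back to \<open>i\<close>, and \<open>z\<close> already lies in
        \<open>P (g j)\<close>.\<close>
      have "character I P f i = j"
        using uniq character_mem_image[OF P fT i(1)] i(2) z(2) by blast
      then have "g j = i" using gc[OF i(1)] by simp
      then show ?thesis using uniq i(2) z(2) by blast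
    next
      case False
      then show ?thesis using uniq PD(1)[OF gI[OF j(1)]] by blast
    qed
  qed
  then obtain h where h: "\<And>x j. x \<in> X \<Longrightarrow> j \<in> I \<Longrightarrow> x \<in> P j \<Longrightarrow> h x \<in> P (g j)"
      "\<And>x. x \<in> X \<Longrightarrow> x \<in> f ` X \<Longrightarrow> f (h x) = x"
    by metis
  define h' where "h' = restrict h X"
  have h'P: "h' ` P j \<subseteq> P (g j)" if "j \<in> I" for j
    using h(1) sub[OF that] that by (auto simp: h'_def)
  have "h x \<in> X" if "x \<in> X" for x
    using that h(1)[OF that] PD(2) gI by blast
  then have h'X: "h' \<in> X \<rightarrow>\<^sub>E X" by (simp add: h'_def)
  \<comment> \<open>Surjectivity of \<open>g\<close> makes \<open>h'\<close> meet every block: the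
    nonempty \<open>P j\<close> with \<open>g j = i\<close> is mapped into
    \<open>P i\<close>.\<close>
  have "h' ` X \<inter> P i \<noteq> {}" if i: "i \<in> I" for i
  proof -
    obtain j where j: "j \<in> I" "i = g j" using Gamma_maps_preimage[OF g i] by blast
    then show ?thesis using PD(1)[OF j(1)] h'P[OF j(1)] sub[OF j(1)] by blast
  qed
  moreover have "\<exists>j\<in>I. h' ` P i \<subseteq> P j" if "i \<in> I" for i
    using h'P[OF that] gI[OF that] by blast
  ultimately have "h' \<in> Sigma_part X I P"
    using h'X by (simp add: Sigma_part_def T_part_def)
  moreover have "compose X f (compose X h' f) = f"
  proof
    fix x show "compose X f (compose X h' f) x = f x"
    proof (cases "x \<in> X")
      case True
      then have "f x \<in> X" using fE by blast
      then show ?thesis using True h(2) by (simp add: compose_eq h'_def)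
    next
      case False
      then show ?thesis using PiE_arb[OF fE] by (simp add: compose_def)
    qed
  qed
  ultimately show ?thesis by blast
qed

theorem proposition5p1:
  fixes X :: "'a set" and I :: "'i set" and P :: "'i \<Rightarrow> 'a set" and f :: "'a \<Rightarrow> 'a"
  assumes "X \<noteq> {}"
    and "indexed_partition X I P"
    and "f \<in> Sigma_part X I P"
  shows "f \<in> reg (Sigma_monoid X I P) \<longleftrightarrow> character I P f \<in> reg (Gamma_monoid I)"
proof -
  note P = assms(2) and f = assms(3)
  let ?c = "character I P f"
  have c: "?c \<in> Gamma_maps I" by (rule character_in_Gamma_maps[OF P f])
  have "(\<exists>h\<in>Sigma_part X I P. compose X f (compose X h f) = f) \<longleftrightarrow>
    (\<exists>g\<in>Gamma_maps I. compose I ?c (compose I g ?c) = ?c)"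
  proof
    assume "\<exists>h\<in>Sigma_part X I P. compose X f (compose X h f) = f"
    then obtain h where h: "h \<in> Sigma_part X I P" "compose X f (compose X h f) = f" by blast
    \<comment> \<open>Closure is needed to apply \<open>character_compose\<close> a second time, to
      the outer composition.\<close>
    have "compose X h f \<in> Sigma_part X I P"
      using monoid.m_closed[OF monoid_Sigma[OF P], of f h] f h(1)
      by (simp add: Sigma_monoid_def transf_monoid_def)
    then have "compose I ?c (compose I (character I P h) ?c) = ?c"
      using character_compose[OF P, of "compose X h f" f] character_compose[OF P, of f h] f h
      by (simp add: Sigma_part_def)
    then show "\<exists>g\<in>Gamma_maps I. compose I ?c (compose I g ?c) = ?c"
      using character_in_Gamma_maps[OF P h(1)] by blast
  next
    assume "\<exists>g\<in>Gamma_maps I. compose I ?c (compose I g ?c) = ?c"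
    then obtain g where g: "g \<in> Gamma_maps I" "compose I ?c (compose I g ?c) = ?c" by blast
    show "\<exists>h\<in>Sigma_part X I P. compose X f (compose X h f) = f"
      by (rule Sigma_pseudo_inverse_exists[OF P f g(1)
            Gamma_pseudo_inverse_is_left_inverse[OF c g]])
  qed
  then show ?thesis
    using f c by (simp add: Sigma_monoid_def Gamma_monoid_def reg_transf_monoid_iff)
qed

end
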